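(* Let $\theta=(k_r)_{r\ge 0}$ be a lacunary sequence and let $q_r=k_r/k_{r-1}$. If $$1<\liminf_{r\to\infty} q_r\le\limsup_{r\to\infty} q_r<\infty,$$ then $ASC=ASC_\theta$.
   Context: Sequences $x=(x_m)$ are real sequences indexed by the positive integers. For positive integers $m,n$, $\langle m,n\rangle$ denotes the greatest common divisor of $m$ and $n$. The number of elements of a finite set $A$ is denoted $|A|$. A lacunary sequence is a strictly increasing sequence $\theta=(k_r)_{r\ge 0}$ of nonnegative integers such that $h_r:=k_r-k_{r-1}\to\infty$ as $r\to\infty$. For $r\ge1$ put $I_r=(k_{r-1},k_r]$ (viewed as a set of integers), and $q_r=k_r/k_{r-1}$ (for those $r\ge 1$ with $k_{r-1}\neq 0$). $ASC$ is the set of all arithmetic statistically convergent sequences: $x\in ASC$ iff for each $\varepsilon>0$ there is a positive integer $n$ such that $$\lim_{t\to\infty}\frac1t\left|\{m\le t: |x_m-x_{\langle m,n\rangle}|\ge\varepsilon\}\right|=0.$$ $ASC_\theta$ is the set of all lacunary arithmetic statistically convergent sequences: $x\in ASC_\theta$ iff for each $\varepsilon>0$ there is a positive integer $n$ such that $$\lim_{r\to\infty}\frac1{h_r}\left|\{m\in I_r: |x_m-x_{\langle m,n\rangle}|\ge\varepsilon\}\right|=0.$$ *)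

theory Defs
  imports "HOL-Analysis.Analysis"
begin

text \<open>
  Sequences indexed by the positive integers are functions on \<^typ>\<open>nat\<close> whose value at
  \<open>0\<close> is never inspected: all index sets below consist of positive integers, and
  \<open>gcd m n\<close> is positive there. Likewise \<open>lac_h\<close>, \<open>lac_I\<close> and \<open>lac_q\<close> are meant for
  \<open>r \<ge> 1\<close>; the value at \<open>r = 0\<close>, and that of \<open>lac_q k 1\<close> when \<open>k 0 = 0\<close>
  (a division by zero), do not affect limits as \<open>r\<close> tends to infinity.
\<close>

definition lac_h :: "(nat \<Rightarrow> nat) \<Rightarrow> nat \<Rightarrow> nat" where
  "lac_h k r = k r - k (r - 1)"

definition lac_I :: "(nat \<Rightarrow> nat) \<Rightarrow> nat \<Rightarrow> nat set" where
  "lac_I k r = {k (r - 1)<..k r}"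

definition lac_q :: "(nat \<Rightarrow> nat) \<Rightarrow> nat \<Rightarrow> real" where
  "lac_q k r = real (k r) / real (k (r - 1))"

definition lacunary :: "(nat \<Rightarrow> nat) \<Rightarrow> bool" where
  "lacunary k \<longleftrightarrow> strict_mono k \<and> filterlim (lac_h k) at_top sequentially"

definition ASC :: "(nat \<Rightarrow> real) set" where
  "ASC = {x. \<forall>\<epsilon>>0. \<exists>n>0.
     (\<lambda>t. 1 / real t * real (card {m \<in> {1..t}. \<bar>x m - x (gcd m n)\<bar> \<ge> \<epsilon>})) \<longlonglongrightarrow> 0}"

definition ASC_lac :: "(nat \<Rightarrow> nat) \<Rightarrow> (nat \<Rightarrow> real) set" where
  "ASC_lac k = {x. \<forall>\<epsilon>>0. \<exists>n>0.
     (\<lambda>r. 1 / real (lac_h k r) * real (card {m \<in> lac_I k r. \<bar>x m - x (gcd m n)\<bar> \<ge> \<epsilon>})) \<longlonglongrightarrow> 0}"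

end

theory Submission
  imports Defs
begin

text \<open>
  For a fixed \<open>n\<close> and \<open>\<epsilon>\<close>, both conditions say that the set of exceptional \<open>m\<close> is small, once in the
  sense of natural density and once in the sense of its relative frequency in the blocks \<open>I\<^sub>r\<close>. These
  two notions of a null set coincide: a block fills at least a fixed proportion of \<open>{1..k r}\<close> when
  \<open>liminf q\<^sub>r > 1\<close>, so density zero passes to the blocks; conversely, summing over the blocks bounds
  the count up to \<open>k r\<close> by a small multiple of \<open>k r\<close>, and \<open>limsup q\<^sub>r < \<infinity>\<close> makes \<open>k r\<close>
  comparable to every \<open>t\<close> in the block \<open>I\<^sub>r\<close>.
\<close>

text \<open>The case \<open>r = 0\<close> fits too: truncated subtraction makes the block empty
  there.\<close>

lemma card_lac_I:
  assumes "mono k"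
  shows "card {m \<in> {1..k r}. P m} =
    card {m \<in> {1..k (r - 1)}. P m} + card {m \<in> lac_I k r. P m}"
proof -
  have "k (r - 1) \<le> k r"
    using assms by (simp add: monoD)
  hence "{m \<in> {1..k r}. P m} = {m \<in> {1..k (r - 1)}. P m} \<union> {m \<in> lac_I k r. P m}"
    by (auto simp: lac_I_def)
  moreover have "{m \<in> {1..k (r - 1)}. P m} \<inter> {m \<in> lac_I k r. P m} = {}"
    by (auto simp: lac_I_def)
  ultimately show ?thesis
    by (simp add: card_Un_disjoint lac_I_def)
qed

text \<open>Once \<open>c < lac_q k r\<close> with \<open>c > 1\<close>, the block has length at
  least \<open>(c - 1) / c * k r\<close>. Passing from the frequency in \<open>{1..k r}\<close> to
  that in the block thus costs at most the factor \<open>c / (c - 1)\<close>.\<close>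

lemma lac_density_zero_if_density_zero:
  assumes k: "strict_mono k"
    and q: "1 < liminf (\<lambda>r. ereal (lac_q k r))"
    and lim: "(\<lambda>t. 1 / real t * real (card {m \<in> {1..t}. P m})) \<longlonglongrightarrow> 0"
  shows "(\<lambda>r. 1 / real (lac_h k r) * real (card {m \<in> lac_I k r. P m})) \<longlonglongrightarrow> 0"
proof -
  obtain c where c: "1 < ereal c" "ereal c < liminf (\<lambda>r. ereal (lac_q k r))"
    using ereal_dense2[OF q] by blast
  have c1: "c > 1"
    using c(1) by simp
  have ev: "eventually (\<lambda>r. c < lac_q k r) sequentially"
    using less_LiminfD[OF c(2)] by simp
  have sub: "(\<lambda>r. c / (c - 1) * (1 / real (k r) * real (card {m \<in> {1..k r}. P m}))) \<longlonglongrightarrow> 0"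
    using tendsto_mult_right_zero[OF LIMSEQ_subseq_LIMSEQ[OF lim k], of "c / (c - 1)"]
    unfolding o_def .
  show ?thesis
  proof (rule tendsto_sandwich[OF _ _ tendsto_const sub])
    show "eventually (\<lambda>r. 1 / real (lac_h k r) * real (card {m \<in> lac_I k r. P m})
        \<le> c / (c - 1) * (1 / real (k r) * real (card {m \<in> {1..k r}. P m}))) sequentially"
      using ev eventually_ge_at_top[of 2]
    proof eventually_elim
      case (elim r)
      \<comment> \<open>As \<open>k 0\<close> may be 0, \<open>r \<ge> 2\<close> is what makes the
        denominator of \<open>lac_q k r\<close> positive.\<close>
      have "k 0 < k (r - 1)" "k (r - 1) < k r"
        using elim(2) by (simp_all add: strict_mono_less[OF k])
      moreover from this have "c * real (k (r - 1)) \<le> real (k r)"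
        using elim(1) by (simp add: lac_q_def field_simps)
      ultimately have h: "0 < (c - 1) / c * real (k r)"
          "(c - 1) / c * real (k r) \<le> real (lac_h k r)"
        using c1 by (simp_all add: lac_h_def of_nat_diff field_simps)
      have "real (card {m \<in> lac_I k r. P m}) \<le> real (card {m \<in> {1..k r}. P m})"
        using card_lac_I[OF strict_mono_mono[OF k], of r P] by simp
      hence "real (card {m \<in> lac_I k r. P m}) / real (lac_h k r)
          \<le> real (card {m \<in> {1..k r}. P m}) / ((c - 1) / c * real (k r))"
        using h by (intro frac_le) auto
      thus ?case
        by (simp add: field_simps)
    qed
  qed simp
qed

lemma density_zero_if_lac_density_zero:
  assumes k: "strict_mono k"
    and q: "limsup (\<lambda>r. ereal (lac_q k r)) < \<infinity>"
    and lim: "(\<lambda>r. 1 / real (lac_h k r) * real (card {m \<in> lac_I k r. P m})) \<longlonglongrightarrow> 0"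
  shows "(\<lambda>t. 1 / real t * real (card {m \<in> {1..t}. P m})) \<longlonglongrightarrow> 0"
proof -
  define a where "a t = real (card {m \<in> {1..t}. P m})" for t
  note mk = strict_mono_mono[OF k]
  obtain C0 where C0: "limsup (\<lambda>r. ereal (lac_q k r)) < ereal C0"
    using ereal_dense2[OF q] by blast
  define C where "C = max C0 1"
  have "eventually (\<lambda>r. lac_q k r < C0) sequentially"
    using Limsup_lessD[OF C0] by simp
  hence evC: "eventually (\<lambda>r. lac_q k r < C) sequentially"
    by eventually_elim (auto simp: C_def)
  have Cpos: "C > 0"
    by (simp add: C_def)
  have a_step: "a (k r) = a (k (r - 1)) + real (card {m \<in> lac_I k r. P m})" for r
    using card_lac_I[OF mk, of r P] by (simp add: a_def)
  have a_le: "a t \<le> real t" for t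
    using card_mono[of "{1..t}" "{m \<in> {1..t}. P m}"] by (simp add: a_def subset_iff)
  have a_mono: "a s \<le> a t" if "s \<le> t" for s t
    unfolding a_def using that by (auto intro!: card_mono)
  have "(\<lambda>t. a t / real t) \<longlonglongrightarrow> 0"
  proof (rule LIMSEQ_I)
    fix e :: real assume e: "e > 0"
    \<comment> \<open>With \<open>k r < C * t\<close>, the blocks after \<open>R\<close> will
      contribute less than \<open>d * C * t = e / 2 * t\<close>.\<close>
    define d where "d = e / (2 * C)"
    have d: "d > 0"
      using e Cpos by (simp add: d_def)
    have "eventually (\<lambda>r. 1 / real (lac_h k r) * real (card {m \<in> lac_I k r. P m}) < d) sequentially"
      by (rule order_tendstoD(2)[OF lim d])
    from eventually_conj[OF evC this] obtain R where R: "\<And>r. r \<ge> R \<Longrightarrow> lac_q k r < C"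
        "\<And>r. r \<ge> R \<Longrightarrow> 1 / real (lac_h k r) * real (card {m \<in> lac_I k r. P m}) < d"
      unfolding eventually_sequentially by blast
    \<comment> \<open>The block lengths telescope, and everything up to \<open>k R\<close> stays a
      constant.\<close>
    have block: "a (k r) \<le> a (k R) + d * (real (k r) - real (k R))" if "R \<le> r" for r
      using that
    proof (induction r rule: dec_induct)
      case (step r)
      have lt: "k r < k (Suc r)"
        using k by (simp add: strict_mono_less)
      have "1 / real (lac_h k (Suc r)) * real (card {m \<in> lac_I k (Suc r). P m}) < d"
        using R(2)[of "Suc r"] step.hyps by simp
      hence "real (card {m \<in> lac_I k (Suc r). P m}) < d * (real (k (Suc r)) - real (k r))"
        using lt by (simp add: lac_h_def of_nat_diff field_simps)
      with step.IH a_step[of "Suc r"] show ?case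
        by (simp add: algebra_simps)
    qed simp
    \<comment> \<open>The second entry makes \<open>k R\<close> less than \<open>e / 2 * t\<close>.
      The first uses \<open>Suc R\<close> rather than \<open>R\<close> so that the block containing
      \<open>t\<close> has \<open>r - 1 > R\<close>, whence \<open>k (r - 1) > 0\<close> even if
      \<open>R = 0\<close>.\<close>
    define T where "T = max (k (Suc R)) (nat \<lceil>2 * real (k R) / e\<rceil>)"
    have "\<bar>a t / real t\<bar> < e" if t: "t > T" for t
    proof -
      \<comment> \<open>Minimality places \<open>t\<close> in the block
        \<open>lac_I k r\<close>.\<close>
      define r where "r = (LEAST r. t \<le> k r)"
      have tr: "t \<le> k r"
        unfolding r_def by (rule LeastI[of _ t]) (rule strict_mono_imp_increasing[OF k])
      have "k (Suc R) < k r"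
        using t tr by (simp add: T_def)
      hence rR: "Suc R < r"
        using k by (simp add: strict_mono_less)
      have rt: "k (r - 1) < t"
        using not_less_Least[of "r - 1" "\<lambda>r. t \<le> k r"] rR by (simp add: r_def[symmetric])
      have "k 0 < k (r - 1)"
        using k rR by (simp add: strict_mono_less)
      hence "real (k r) \<le> C * real (k (r - 1))"
        using R(1)[of r] rR by (simp add: lac_q_def field_simps)
      also have "\<dots> < C * real t"
        using rt Cpos by simp
      finally have kt: "d * real (k r) < e / 2 * real t"
        using d Cpos mult_strict_left_mono[of "real (k r)" "C * real t" d] by (simp add: d_def)
      have "2 * real (k R) / e < real t"
        using t by (simp add: T_def) linarith
      hence kR: "real (k R) < e / 2 * real t"
        using e by (simp add: field_simps)
      have "a t \<le> a (k R) + d * (real (k r) - real (k R))"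
        using a_mono[OF tr] block[of r] rR by simp
      also have "\<dots> \<le> real (k R) + d * real (k r)"
        using a_le[of "k R"] d by (simp add: algebra_simps add_increasing2)
      also have "\<dots> < e * real t"
        using kt kR by (simp add: field_simps)
      finally have "a t < e * real t" .
      moreover have "t > 0" "a t \<ge> 0"
        using t by (simp_all add: a_def)
      ultimately show ?thesis
        by (simp add: field_simps)
    qed
    thus "\<exists>T. \<forall>t\<ge>T. norm (a t / real t - 0) < e"
      by (intro exI[of _ "Suc T"]) auto
  qed
  thus ?thesis
    by (simp add: a_def)
qed

theorem corollary2p8:
  fixes k :: "nat \<Rightarrow> nat"
  assumes "lacunary k"
    and "1 < liminf (\<lambda>r. ereal (lac_q k r))"
    and "liminf (\<lambda>r. ereal (lac_q k r)) \<le> limsup (\<lambda>r. ereal (lac_q k r))"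
    and "limsup (\<lambda>r. ereal (lac_q k r)) < \<infinity>"
  shows "ASC = ASC_lac k"
proof -
  have k: "strict_mono k"
    using assms(1) by (simp add: lacunary_def)
  \<comment> \<open>As \<open>P\<close> is arbitrary, the same \<open>n\<close> serves both
    definitions for each \<epsilon>.\<close>
  have "(\<lambda>t. 1 / real t * real (card {m \<in> {1..t}. P m})) \<longlonglongrightarrow> 0 \<longleftrightarrow>
      (\<lambda>r. 1 / real (lac_h k r) * real (card {m \<in> lac_I k r. P m})) \<longlonglongrightarrow> 0" for P
    using lac_density_zero_if_density_zero[OF k assms(2)]
      density_zero_if_lac_density_zero[OF k assms(4)] by blast
  thus ?thesis
    unfolding ASC_def ASC_lac_def by presburger
qed

end
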